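(* Let $H\in(0,1)$. For $t>0$ and $\lambda\in\mathbb{R}$ define $$P(t,\lambda)=\varphi(t\lambda)\sqrt{dV_t/dt},\qquad P^*(t,\lambda)=e^{i\lambda t}\,\overline{P(t,\lambda)}.$$ For every $\lambda\in\mathbb{R}$ (and $t>0$) these functions satisfy the equations $$\frac{\partial P(t,\lambda)}{\partial t}=i\lambda P(t,\lambda)-\gamma_tP^*(t,\lambda)$$ and $$\frac{\partial P^*(t,\lambda)}{\partial t}=-\gamma_tP(t,\lambda),$$ where $\gamma_t=(H-1/2)/t$.
   Context: $\Gamma$ is Euler's gamma function and $J_\nu$ the Bessel function of the first kind of order $\nu$. $V_t=d_H^2\,t^{2-2H}$ with $d_H^2=\dfrac{\Gamma(3/2-H)}{2H\,\Gamma(H+1/2)\,\Gamma(3-2H)}$. The function $\varphi:\mathbb{R}\to\mathbb{C}$ is $$\varphi(z)=\Gamma(1-H)\Big(\frac z4\Big)^H e^{iz/2}\Big(J_{-H}\Big(\frac z2\Big)+iJ_{1-H}\Big(\frac z2\Big)\Big)\ (z\ne0),\qquad \varphi(0)=1.$$ Here $z^{-\nu}J_\nu(z)$ is always understood as the entire even function $\sum_{k\ge0}\frac{(-1)^k 2^{-\nu}(z/2)^{2k}}{k!\,\Gamma(k+\nu+1)}$, so $z^HJ_{-H}(z)$ and $z^HJ_{1-H}(z)=z\cdot z^{-(1-H)}J_{1-H}(z)$ are entire and $\varphi$ is entire. *)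

theory Defs
  imports "HOL-Analysis.Analysis"
begin

(* The entire even function z^(-nu) J_nu(z). *)
definition bessel_entire :: "real \<Rightarrow> complex \<Rightarrow> complex" where
  "bessel_entire \<nu> z =
     (\<Sum>k. (-1) ^ k * of_real (2 powr (- \<nu>)) * (z / 2) ^ (2 * k) /
           (fact k * of_real (Gamma (of_nat k + \<nu> + 1))))"

(* Principal branch of z^nu.  In phi all branch choices cancel, see phi_eq_entire. *)
definition bessel_J :: "real \<Rightarrow> complex \<Rightarrow> complex" where
  "bessel_J \<nu> z = z powr of_real \<nu> * bessel_entire \<nu> z"

definition phi :: "real \<Rightarrow> real \<Rightarrow> complex" where
  "phi H z = (if z = 0 then 1 else
     of_real (Gamma (1 - H)) * (of_real z / 4) powr of_real H * exp (\<i> * of_real z / 2) *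
     (bessel_J (- H) (of_real z / 2) + \<i> * bessel_J (1 - H) (of_real z / 2)))"

definition dH_sq :: "real \<Rightarrow> real" where
  "dH_sq H = Gamma (3/2 - H) / (2 * H * Gamma (H + 1/2) * Gamma (3 - 2 * H))"

definition V :: "real \<Rightarrow> real \<Rightarrow> real" where
  "V H t = dH_sq H * t powr (2 - 2 * H)"

definition P :: "real \<Rightarrow> real \<Rightarrow> real \<Rightarrow> complex" where
  "P H t l = phi H (t * l) * of_real (sqrt (deriv (V H) t))"

definition Pstar :: "real \<Rightarrow> real \<Rightarrow> real \<Rightarrow> complex" where
  "Pstar H t l = exp (\<i> * of_real l * of_real t) * cnj (P H t l)"

definition gam :: "real \<Rightarrow> real \<Rightarrow> real" where
  "gam H t = (H - 1/2) / t"

lemma bessel_entire_0: "bessel_entire \<nu> 0 = of_real (2 powr (- \<nu>) / Gamma (\<nu> + 1))"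
proof -
  have "bessel_entire \<nu> 0 = (\<Sum>k\<in>{0}. (-1) ^ k * of_real (2 powr (- \<nu>)) * (0 / 2) ^ (2 * k) /
           (fact k * of_real (Gamma (of_nat k + \<nu> + 1))))"
    unfolding bessel_entire_def by (rule suminf_finite) auto
  then show ?thesis by simp
qed

(* On the whole real line, phi is the entire function obtained by reading
   z^H J_{-H}(z) and z^H J_{1-H}(z) as entire functions. *)
lemma phi_eq_entire:
  assumes "0 < H" "H < 1"
  shows "phi H z = of_real (Gamma (1 - H) * 2 powr (- H)) * exp (\<i> * of_real z / 2) *
     (bessel_entire (- H) (of_real z / 2) +
      \<i> * (of_real z / 2) * bessel_entire (1 - H) (of_real z / 2))"
proof (cases "z = 0")
  case True
  have "Gamma (1 - H) > 0" using assms by (simp add: Gamma_real_pos)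
  then have "Gamma (1 - H) \<noteq> 0" by simp
  then have "complex_of_real (Gamma (1 - H) * 2 powr (- H)) *
      of_real (2 powr (- (- H)) / Gamma (- H + 1)) = 1"
    unfolding of_real_mult[symmetric] by (simp add: powr_minus field_simps)
  then show ?thesis
    using True by (simp add: phi_def bessel_entire_0)
next
  case False
  define w where "w = complex_of_real z / 2"
  have w: "w \<noteq> 0" using False by (simp add: w_def)
  have eq: "complex_of_real z / 4 = of_real (1/2) * w" by (simp add: w_def)
  have q: "(complex_of_real z / 4) powr of_real H = of_real (2 powr (- H)) * w powr of_real H"
  proof -
    have "(complex_of_real z / 4) powr of_real H =
        complex_of_real (1/2) powr of_real H * w powr of_real H"
      unfolding eq by (rule powr_times_real_left) auto
    also have "complex_of_real (1/2) powr of_real H = of_real ((1/2) powr H)"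
      by (rule powr_of_real) auto
    also have "(1/2::real) powr H = 2 powr (- H)"
      by (simp add: powr_minus powr_divide field_simps)
    finally show ?thesis by simp
  qed
  have a: "w powr of_real H * w powr of_real (- H) = 1"
    using w by (simp flip: powr_add)
  have b: "w powr of_real H * w powr of_real (1 - H) = w"
    using w by (simp flip: powr_add)
  have "phi H z = of_real (Gamma (1 - H) * 2 powr (- H)) * exp (\<i> * of_real z / 2) *
     ((w powr of_real H * w powr of_real (- H)) * bessel_entire (- H) w +
      \<i> * (w powr of_real H * w powr of_real (1 - H)) * bessel_entire (1 - H) w)"
    using False unfolding phi_def bessel_J_def q by (simp add: w_def algebra_simps)
  then show ?thesis unfolding a b by (simp add: w_def)
qed

end

(* Put E_\<nu>(w) = w^(-\<nu>) J_\<nu>(w). The Bessel relations E_\<nu>' = -w E_(\<nu>+1) and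
   E_(\<nu>-1) = 2\<nu> E_\<nu> - w^2 E_(\<nu>+1) show that F\<plusminus>(w) = e^(iw) (E_(-H)(w) \<plusminus> i w E_(1-H)(w)) satisfy
   F+' = 2i F+ + i(2H-1) e^(iw) E_(1-H)  and  F-' = -i(2H-1) e^(iw) E_(1-H),
   while F+ - F- = 2i w e^(iw) E_(1-H). Up to one common factor const * t^(1/2-H), whose logarithmic
   derivative is -\<gamma>_t, P and P* are F+ and F- at w = t\<lambda>/2, and the system follows. *)
theory Submission
  imports Defs
begin

section \<open>Power series in u = (z/2)^2 and their coefficients\<close>

definition bessel_coeff :: "real \<Rightarrow> nat \<Rightarrow> complex" where
  "bessel_coeff \<nu> k = (-1) ^ k * of_real (rGamma (of_nat k + \<nu> + 1)) / fact k"

text \<open>The formulas agree even at poles of \<open>Gamma\<close>: there \<open>Gamma\<close>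
  takes the value 0, so the quotient is 0, which is also the value of \<open>rGamma\<close>.\<close>

lemma bessel_entire_eq:
  "bessel_entire \<nu> z = (\<Sum>k. of_real (2 powr (- \<nu>)) * (bessel_coeff \<nu> k * ((z / 2)\<^sup>2) ^ k))"
  unfolding bessel_entire_def bessel_coeff_def power_mult rGamma_inverse_Gamma of_real_inverse
  by (simp only: divide_inverse inverse_mult_distrib mult_ac)

text \<open>The factor k+1 cancels in (k+1)!, and raising the index or the order by one shifts the
  Gamma argument alike.\<close>

lemma bessel_coeff_Suc:
  "of_nat (Suc k) * bessel_coeff \<nu> (Suc k) = - bessel_coeff (\<nu> + 1) k"
proof -
  have "of_nat (Suc k) \<noteq> (0::complex)" by (rule of_nat_neq_0)
  moreover have shift: "of_nat (Suc k) + \<nu> + 1 = of_nat k + (\<nu> + 1) + 1" by simp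
  ultimately show ?thesis
    unfolding bessel_coeff_def shift by (simp add: divide_simps del: of_nat_Suc)
qed

text \<open>This is x rGamma(x+1) = rGamma(x), valid at every x including the poles of
  Gamma.\<close>

lemma bessel_coeff_shift_order:
  "(of_nat k + of_real \<nu>) * bessel_coeff \<nu> k = bessel_coeff (\<nu> - 1) k"
proof -
  have "(of_nat k + of_real \<nu>) * complex_of_real (rGamma (of_nat k + \<nu> + 1)) =
        of_real ((of_nat k + \<nu>) * rGamma (of_nat k + \<nu> + 1))"
    by simp
  also have "\<dots> = of_real (rGamma (of_nat k + \<nu>))"
    by (simp only: rGamma_plus1)
  finally show ?thesis
    unfolding bessel_coeff_def by (simp add: algebra_simps)
qed

lemma summable_bessel_coeff: "summable (\<lambda>k. bessel_coeff \<nu> k * u ^ k)"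
proof -
  \<comment> \<open>From this index on, k+1 is at least 2|u| and k+\<nu>+1 is at least 1. Their
    product \<open>q\<close> is, up to sign, the ratio of coefficient k to coefficient k+1.\<close>
  define N where "N = nat \<lceil>\<bar>\<nu>\<bar> + 2 * norm u\<rceil>"
  show ?thesis
  proof (rule summable_ratio_test[of "1/2" N])
    fix k assume "N \<le> k"
    then have k: "\<bar>\<nu>\<bar> + 2 * norm u \<le> real k"
      unfolding N_def by linarith
    define q where "q = real (Suc k) * (real k + \<nu> + 1)"
    have c: "bessel_coeff (\<nu> + 1) k = - (of_nat (Suc k) * bessel_coeff \<nu> (Suc k))"
      by (simp only: bessel_coeff_Suc minus_minus)
    have "bessel_coeff \<nu> k = bessel_coeff (\<nu> + 1 - 1) k" by simp
    also have "\<dots> = (of_nat k + of_real (\<nu> + 1)) * bessel_coeff (\<nu> + 1) k"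
      by (rule bessel_coeff_shift_order[symmetric])
    also have "\<dots> = - of_real q * bessel_coeff \<nu> (Suc k)"
      unfolding q_def c by (simp add: algebra_simps)
    finally have "norm (bessel_coeff \<nu> k) = \<bar>q\<bar> * norm (bessel_coeff \<nu> (Suc k))"
      by (simp add: norm_mult)
    moreover have "2 * norm u \<le> q"
    proof -
      have "2 * norm u * 1 \<le> real (Suc k) * (real k + \<nu> + 1)"
      proof (rule mult_mono)
        show "2 * norm u \<le> real (Suc k)" using k by simp
        show "1 \<le> real k + \<nu> + 1" using k norm_ge_zero[of u] by linarith
      qed auto
      then show ?thesis by (simp add: q_def)
    qed
    ultimately have "2 * norm u * norm (bessel_coeff \<nu> (Suc k)) \<le> norm (bessel_coeff \<nu> k)"
      by (simp add: mult_right_mono)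
    then have "(2 * norm u * norm (bessel_coeff \<nu> (Suc k))) * norm u ^ k
        \<le> norm (bessel_coeff \<nu> k) * norm u ^ k"
      by (rule mult_right_mono) simp
    then show "norm (bessel_coeff \<nu> (Suc k) * u ^ Suc k) \<le> 1/2 * norm (bessel_coeff \<nu> k * u ^ k)"
      by (simp add: norm_mult norm_power algebra_simps)
  qed simp
qed

text \<open>The Bessel-Clifford function of order \<nu> at -u.\<close>

definition bessel_series :: "real \<Rightarrow> complex \<Rightarrow> complex" where
  "bessel_series \<nu> u = (\<Sum>k. bessel_coeff \<nu> k * u ^ k)"

lemma bessel_entire_eq_series:
  "bessel_entire \<nu> z = of_real (2 powr (- \<nu>)) * bessel_series \<nu> ((z / 2)\<^sup>2)"
  unfolding bessel_entire_eq bessel_series_def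
  by (rule suminf_mult[OF summable_bessel_coeff])

lemma bessel_series_deriv:
  "(bessel_series \<nu> has_field_derivative - bessel_series (\<nu> + 1) u) (at u)"
proof -
  have "((\<lambda>u. \<Sum>k. bessel_coeff \<nu> k * u ^ k) has_field_derivative
        (\<Sum>k. diffs (bessel_coeff \<nu>) k * u ^ k)) (at u)"
    by (rule termdiffs_strong_converges_everywhere[OF summable_bessel_coeff])
  moreover have "(\<Sum>k. diffs (bessel_coeff \<nu>) k * u ^ k) = - bessel_series (\<nu> + 1) u"
    unfolding diffs_def bessel_coeff_Suc bessel_series_def
    by (simp add: suminf_minus summable_bessel_coeff)
  ultimately show ?thesis
    unfolding bessel_series_def[abs_def] by simp
qed

text \<open>Split the factor k+\<nu> of \<open>bessel_coeff_shift_order\<close>: the part \<nu>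
  gives the first term, the part k gives u times the derivative of the series.\<close>

lemma bessel_series_recurrence:
  "bessel_series (\<nu> - 1) u = of_real \<nu> * bessel_series \<nu> u - u * bessel_series (\<nu> + 1) u"
proof -
  have nu: "(\<lambda>k. of_real \<nu> * (bessel_coeff \<nu> k * u ^ k)) sums (of_real \<nu> * bessel_series \<nu> u)"
    unfolding bessel_series_def by (intro sums_mult summable_sums summable_bessel_coeff)
  have "(\<lambda>k. - u * (bessel_coeff (\<nu> + 1) k * u ^ k)) sums (- u * bessel_series (\<nu> + 1) u)"
    unfolding bessel_series_def by (intro sums_mult summable_sums summable_bessel_coeff)
  also have "(\<lambda>k. - u * (bessel_coeff (\<nu> + 1) k * u ^ k)) =
      (\<lambda>k. of_nat (Suc k) * bessel_coeff \<nu> (Suc k) * u ^ Suc k)"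
    unfolding bessel_coeff_Suc by (simp add: fun_eq_iff)
  \<comment> \<open>The index shift adds only the term k = 0, which vanishes.\<close>
  finally have "(\<lambda>k. of_nat k * bessel_coeff \<nu> k * u ^ k) sums (- u * bessel_series (\<nu> + 1) u)"
    by (subst (asm) sums_Suc_iff) simp
  from sums_add[OF nu this]
  have "(\<lambda>k. bessel_coeff (\<nu> - 1) k * u ^ k) sums
      (of_real \<nu> * bessel_series \<nu> u - u * bessel_series (\<nu> + 1) u)"
    unfolding bessel_coeff_shift_order[symmetric] by (simp add: algebra_simps)
  then show ?thesis
    unfolding bessel_series_def[of "\<nu> - 1"] by (rule sums_unique[symmetric])
qed

section \<open>Bessel relations for the entire functions\<close>

lemma two_powr_minus_Suc: "complex_of_real (2 powr (- (\<nu> + 1))) = of_real (2 powr (- \<nu>)) / 2"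
proof -
  have "(2::real) powr (- (\<nu> + 1)) = 2 powr (- \<nu>) / 2"
    using powr_diff[of 2 "- \<nu>" 1] by simp
  then show ?thesis by (simp only: of_real_divide of_real_numeral)
qed

text \<open>The chain rule for (z/2)^2 gives the factor z/2; its 1/2 is absorbed into the
  normalisation of order \<nu>+1.\<close>

lemma bessel_entire_deriv:
  "(bessel_entire \<nu> has_field_derivative - z * bessel_entire (\<nu> + 1) z) (at z)"
proof -
  have "((\<lambda>z. of_real (2 powr (- \<nu>)) * bessel_series \<nu> ((z / 2)\<^sup>2)) has_field_derivative
      of_real (2 powr (- \<nu>)) * (- bessel_series (\<nu> + 1) ((z / 2)\<^sup>2) * (z / 2))) (at z)"
    by (auto intro!: derivative_eq_intros DERIV_chain2[OF bessel_series_deriv])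
  then show ?thesis
    unfolding bessel_entire_eq_series[abs_def] two_powr_minus_Suc by (simp add: mult_ac)
qed

lemma bessel_entire_recurrence:
  "bessel_entire (\<nu> - 1) z = 2 * of_real \<nu> * bessel_entire \<nu> z - z\<^sup>2 * bessel_entire (\<nu> + 1) z"
proof -
  have "complex_of_real (2 powr (- (\<nu> - 1))) = of_real (2 powr (- \<nu>)) * 2"
    using two_powr_minus_Suc[of "\<nu> - 1"] by simp
  then show ?thesis
    unfolding bessel_entire_eq_series bessel_series_recurrence two_powr_minus_Suc
    by (simp add: field_simps power2_eq_square)
qed

text \<open>The power series has real coefficients.\<close>

lemma cnj_bessel_entire: "cnj (bessel_entire \<nu> z) = bessel_entire \<nu> (cnj z)"
proof -
  have "(\<lambda>k. cnj (bessel_coeff \<nu> k * u ^ k)) sums cnj (bessel_series \<nu> u)" for u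
    unfolding bessel_series_def sums_cnj by (intro summable_sums summable_bessel_coeff)
  then have "cnj (bessel_series \<nu> u) = bessel_series \<nu> (cnj u)" for u
    unfolding bessel_series_def by (simp add: bessel_coeff_def sums_iff)
  then show ?thesis
    by (simp add: bessel_entire_eq_series)
qed

section \<open>The two waves F+ and F-\<close>

text \<open>The sign \<open>\<sigma> = 1\<close> belongs to \<^const>\<open>P\<close> and \<open>\<sigma> = -1\<close> to \<^const>\<open>Pstar\<close>.\<close>

definition bessel_wave :: "real \<Rightarrow> complex \<Rightarrow> complex \<Rightarrow> complex" where
  "bessel_wave H \<sigma> w =
     exp (\<i> * w) * (bessel_entire (- H) w + \<sigma> * \<i> * w * bessel_entire (1 - H) w)"

lemma bessel_wave_deriv:
  "(bessel_wave H \<sigma> has_field_derivative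
      (1 + \<sigma>) * \<i> * bessel_wave H 1 w
      + \<sigma> * \<i> * of_real (2 * H - 1) * exp (\<i> * w) * bessel_entire (1 - H) w) (at w)"
proof -
  have 1: "(bessel_entire (- H) has_field_derivative - w * bessel_entire (1 - H) w) (at w)"
    using bessel_entire_deriv[of "- H" w] by (simp add: add.commute)
  have 2: "bessel_entire (- H) w =
      2 * of_real (1 - H) * bessel_entire (1 - H) w - w\<^sup>2 * bessel_entire (1 - H + 1) w"
    using bessel_entire_recurrence[of "1 - H" w] by simp
  show ?thesis
    unfolding bessel_wave_def[abs_def]
    apply (rule derivative_eq_intros 1 bessel_entire_deriv refl)+
    \<comment> \<open>Fact \<open>2\<close> expresses order -H through orders 1-H and 2-H on both
      sides; what remains is a polynomial identity, valid for every \<sigma>.\<close>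
    apply (simp add: 2 algebra_simps power2_eq_square)
    done
qed

lemma bessel_wave_diff:
  "bessel_wave H 1 w - bessel_wave H (-1) w = 2 * \<i> * w * exp (\<i> * w) * bessel_entire (1 - H) w"
  unfolding bessel_wave_def by (simp add: algebra_simps)

text \<open>At real x both Bessel factors are real, so conjugation only flips the signs of i. For x
  = t\<lambda>/2 the prefactor is the e^(i\<lambda>t) of \<open>Pstar\<close>.\<close>

lemma cnj_bessel_wave:
  "exp (2 * \<i> * of_real x) * cnj (bessel_wave H 1 (of_real x)) = bessel_wave H (-1) (of_real x)"
proof -
  have "exp (2 * \<i> * of_real x) * exp (- (\<i> * of_real x)) = exp (\<i> * complex_of_real x)"
    unfolding exp_add[symmetric] by (simp add: algebra_simps)
  moreover have "cnj (exp (\<i> * complex_of_real x)) = exp (- (\<i> * of_real x))"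
    by (simp add: exp_cnj)
  ultimately show ?thesis
    by (simp add: bessel_wave_def cnj_bessel_entire mult.assoc[symmetric])
qed

section \<open>The common amplitude of \<open>P\<close> and \<open>Pstar\<close>\<close>

lemma deriv_V:
  assumes "0 < t"
  shows "deriv (V H) t = dH_sq H * (2 - 2 * H) * t powr (1 - 2 * H)"
proof -
  have "(V H has_real_derivative dH_sq H * (2 - 2 * H) * t powr (1 - 2 * H)) (at t)"
    unfolding V_def[abs_def] using assms by (auto intro!: derivative_eq_intros)
  then show ?thesis by (rule DERIV_imp_deriv)
qed

text \<open>The constant in front of \<phi> times the square root of dV/dt, whose exponent 1-2H is
  thereby halved.\<close>

definition amplitude :: "real \<Rightarrow> real \<Rightarrow> real" where
  "amplitude H t = Gamma (1 - H) * 2 powr (- H) * sqrt (dH_sq H * (2 - 2 * H)) * t powr (1/2 - H)"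

lemma amplitude_deriv:
  assumes "0 < t"
  shows "(amplitude H has_real_derivative - gam H t * amplitude H t) (at t)"
proof -
  have "((\<lambda>s. s powr (1/2 - H)) has_real_derivative (1/2 - H) * t powr (1/2 - H - 1)) (at t)"
    using assms by (rule has_real_derivative_powr)
  also have "(1/2 - H) * t powr (1/2 - H - 1) = - gam H t * t powr (1/2 - H)"
    using assms unfolding gam_def powr_diff[of t "1/2 - H" 1]
    by (simp add: minus_divide_left[symmetric] algebra_simps diff_divide_distrib)
  finally show ?thesis
    unfolding amplitude_def[abs_def] by (rule DERIV_cmult[THEN DERIV_cong]) simp
qed

lemma P_eq_wave:
  assumes "0 < H" "H < 1" "0 < s"
  shows "P H s l = of_real (amplitude H s) * bessel_wave H 1 (of_real (s * l / 2))"
proof -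
  have "sqrt (s powr (1 - 2 * H)) = s powr (1/2 - H)"
    using assms(3) by (simp add: powr_half_sqrt[symmetric] powr_powr field_simps)
  then have "sqrt (deriv (V H) s) = sqrt (dH_sq H * (2 - 2 * H)) * s powr (1/2 - H)"
    by (simp only: deriv_V[OF assms(3)] real_sqrt_mult)
  then show ?thesis
    unfolding P_def phi_eq_entire[OF assms(1,2)] amplitude_def bessel_wave_def
    by (simp add: algebra_simps)
qed

lemma Pstar_eq_wave:
  assumes "0 < H" "H < 1" "0 < s"
  shows "Pstar H s l = of_real (amplitude H s) * bessel_wave H (-1) (of_real (s * l / 2))"
proof -
  have "exp (\<i> * of_real l * of_real s) = exp (2 * \<i> * complex_of_real (s * l / 2))"
    by (simp add: mult_ac)
  then show ?thesis
    unfolding Pstar_def P_eq_wave[OF assms] cnj_bessel_wave[symmetric]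
    by (simp only: complex_cnj_mult complex_cnj_complex_of_real mult.left_commute)
qed

text \<open>Product rule with the chain rule along s \<mapsto> sl/2, stated for general
  \<open>f\<close> so that it serves both waves.\<close>

lemma modulated_wave_deriv:
  fixes t l :: real and f :: "complex \<Rightarrow> complex"
  assumes "0 < t" and "(f has_field_derivative f') (at (of_real (t * l / 2)))"
  shows "((\<lambda>s. of_real (amplitude H s) * f (of_real (s * l / 2))) has_vector_derivative
      of_real (amplitude H t) * (of_real (l / 2) * f' - of_real (gam H t) * f (of_real (t * l / 2)))) (at t)"
proof -
  have a: "((\<lambda>s. complex_of_real (amplitude H s)) has_vector_derivative
      of_real (- gam H t * amplitude H t)) (at t)"
    using has_vector_derivative_of_real amplitude_deriv[OF assms(1)] by blast
  have "((\<lambda>s. complex_of_real (s * l / 2)) has_vector_derivative of_real (l / 2)) (at t)"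
    by (rule has_vector_derivative_of_real) (auto intro!: derivative_eq_intros)
  then have "((f \<circ> (\<lambda>s. of_real (s * l / 2))) has_vector_derivative of_real (l / 2) * f') (at t)"
    by (rule field_vector_diff_chain_at) (rule assms(2))
  from has_vector_derivative_mult[OF a this] show ?thesis
    by (simp add: o_def algebra_simps)
qed

section \<open>The differential system\<close>

theorem theorem5p2:
  fixes H t l :: real
  assumes "0 < H" and "H < 1" and "0 < t"
  shows "((\<lambda>s. P H s l) has_vector_derivative
            \<i> * of_real l * P H t l - of_real (gam H t) * Pstar H t l) (at t) \<and>
         ((\<lambda>s. Pstar H s l) has_vector_derivative
            - of_real (gam H t) * P H t l) (at t)"
proof
  define w where "w = complex_of_real (t * l / 2)"
  \<comment> \<open>The t in w cancels the 1/t in \<gamma>_t. The factor 2w is the one in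
    \<open>bessel_wave_diff\<close>, so the extra term of either derivative becomes a multiple of F+
    - F-.\<close>
  have "of_real (l / 2) * of_real (2 * H - 1) = 2 * w * of_real (gam H t)"
    using assms(3) unfolding w_def gam_def by (simp add: field_simps)
  then have "of_real (l / 2) * of_real (2 * H - 1) * (\<i> * exp (\<i> * w) * bessel_entire (1 - H) w) =
      2 * w * of_real (gam H t) * (\<i> * exp (\<i> * w) * bessel_entire (1 - H) w)"
    by (rule arg_cong)
  then have coupling:
    "of_real (l / 2) * (\<i> * of_real (2 * H - 1) * exp (\<i> * w) * bessel_entire (1 - H) w) =
      of_real (gam H t) * (bessel_wave H 1 w - bessel_wave H (-1) w)"
    unfolding bessel_wave_diff by (simp only: mult_ac)
  note wave = modulated_wave_deriv[OF assms(3) bessel_wave_deriv, of H H _ l, folded w_def]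
  show "((\<lambda>s. P H s l) has_vector_derivative
            \<i> * of_real l * P H t l - of_real (gam H t) * Pstar H t l) (at t)"
  \<comment> \<open>The wave form is established for s > 0, so the derivative is transferred on that
    open half-line.\<close>
  proof (rule has_vector_derivative_transform_within_open)
    \<comment> \<open>By \<open>coupling\<close>, \<gamma>(F+ - F-) - \<gamma> F+ = -\<gamma> F-,
      while (l/2) 2i F+ = i l F+.\<close>
    have "of_real (amplitude H t) *
        (of_real (l / 2) * ((1 + 1) * \<i> * bessel_wave H 1 w
            + 1 * \<i> * of_real (2 * H - 1) * exp (\<i> * w) * bessel_entire (1 - H) w)
          - of_real (gam H t) * bessel_wave H 1 w)
      = \<i> * of_real l * P H t l - of_real (gam H t) * Pstar H t l"
      unfolding P_eq_wave[OF assms] Pstar_eq_wave[OF assms] w_def[symmetric]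
        distrib_left[of "of_real (l / 2)"] mult_1 coupling
      by (simp add: algebra_simps)
    then show "((\<lambda>s. of_real (amplitude H s) * bessel_wave H 1 (of_real (s * l / 2)))
        has_vector_derivative
        \<i> * of_real l * P H t l - of_real (gam H t) * Pstar H t l) (at t)"
      using wave[of 1] by (simp only:)
  qed (use assms P_eq_wave in \<open>auto intro: open_greaterThan[of 0]\<close>)
  show "((\<lambda>s. Pstar H s l) has_vector_derivative - of_real (gam H t) * P H t l) (at t)"
  proof (rule has_vector_derivative_transform_within_open)
    \<comment> \<open>For \<sigma> = -1 the F+ term drops out, and -\<gamma>(F+ - F-) - \<gamma> F-
      = -\<gamma> F+.\<close>
    have "of_real (amplitude H t) *
        (of_real (l / 2) * ((1 + - 1) * \<i> * bessel_wave H 1 w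
            + - 1 * \<i> * of_real (2 * H - 1) * exp (\<i> * w) * bessel_entire (1 - H) w)
          - of_real (gam H t) * bessel_wave H (-1) w)
      = of_real (amplitude H t) *
        (- (of_real (l / 2) * (\<i> * of_real (2 * H - 1) * exp (\<i> * w) * bessel_entire (1 - H) w))
          - of_real (gam H t) * bessel_wave H (-1) w)"
      by simp
    also have "\<dots> = - of_real (gam H t) * P H t l"
      unfolding P_eq_wave[OF assms] w_def[symmetric] coupling by (simp add: algebra_simps)
    finally show "((\<lambda>s. of_real (amplitude H s) * bessel_wave H (-1) (of_real (s * l / 2)))
        has_vector_derivative - of_real (gam H t) * P H t l) (at t)"
      using wave[of "-1"] by (simp only:)
  qed (use assms Pstar_eq_wave in \<open>auto intro: open_greaterThan[of 0]\<close>)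
qed

end
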